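(* Let $D,Q\in\mathbb N$ with $(D,Q)=1$ and $D/Q>1$, and suppose $D/Q$ is not the square of a rational number. Let $q$ be the smallest (positive) divisor of $Q$ such that $Q\mid q^2$, and put $D_1=Dq^2/Q\in\mathbb N$. Let $m\ge 0$ be an integer such that $\sqrt{D/Q}$ has the periodic continued fraction expansion $\sqrt{D/Q}=[b_0,\{b_1,\ldots,b_m,2b_0\}]$ with $b_0,\ldots,b_m\in\mathbb N$ ($m$ is not assumed to be smallest possible), and let $r_k/s_k$, $k=0,1,2,\ldots$, be the $k$th convergent of $\sqrt{D/Q}$. Let $r+s\sqrt{D_1}$ ($r,s\in\mathbb Z$) be a unit $>1$ of the ring $\mathbb Z[\sqrt{D_1}]$, and let $t=(r,q)$. Then $(r/t,\,sq/t)$ is a convergent of $\sqrt{D/Q}$, i.e., $(r/t,sq/t)=(r_k,s_k)$ for some $k\ge 0$. Moreover, if $(r/t,sq/t)=(r_k,s_k)$, then there is another unit $r'+s'\sqrt{D_1}$ ($r',s'\in\mathbb Z$) of $\mathbb Z[\sqrt{D_1}]$ such that $(r_{k+m+1},s_{k+m+1})=(r'/t,\,s'q/t)$, and $(r',q)=t$ for the same number $t$.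
   Context: $\mathbb N=\{1,2,3,\ldots\}$. For integers $a,b$ (not both zero), $(a,b)$ denotes the greatest common divisor when used as in $(D,Q)=1$, $t=(r,q)$, $(r',q)=t$; in expressions such as $(r/t,sq/t)=(r_k,s_k)$ it denotes an ordered pair. The notation $[b_0,\{b_1,\ldots,b_m,2b_0\}]$ denotes the infinite simple continued fraction with initial term $b_0$ followed by the block $b_1,\ldots,b_m,2b_0$ (of length $m+1$) repeated periodically forever; for $D/Q>1$ as in the claim, $\sqrt{D/Q}$ always has an expansion of this form. Convergents $r_k/s_k=[b_0,b_1,\ldots,b_k]$ are indexed from $k=0$ and written in lowest terms with $r_k,s_k\in\mathbb N$, $(r_k,s_k)=1$. The number $D_1$ is a natural number and is not a square. *)

theory Defs
  imports Complex_Main "HOL-Algebra.Ring"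
begin

fun finite_cf :: "nat list \<Rightarrow> rat" where
  "finite_cf [] = 0"  (* irrelevant: only nonempty lists are used *)
| "finite_cf [x] = of_nat x"
| "finite_cf (x # y # ys) = of_nat x + 1 / finite_cf (y # ys)"

definition cf_value :: "(nat \<Rightarrow> nat) \<Rightarrow> nat \<Rightarrow> rat" where
  "cf_value a k = finite_cf (map a [0..<Suc k])"

text \<open>\<^const>\<open>quotient_of\<close> yields the numerator and denominator in lowest terms,
  the denominator being positive.\<close>

definition cf_convergent :: "(nat \<Rightarrow> nat) \<Rightarrow> nat \<Rightarrow> int \<times> int" where
  "cf_convergent a k = quotient_of (cf_value a k)"

definition simple_cf_of :: "(nat \<Rightarrow> nat) \<Rightarrow> real \<Rightarrow> bool" where
  "simple_cf_of a x \<longleftrightarrow>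
     (\<forall>i>0. a i > 0) \<and> (\<lambda>k. of_rat (cf_value a k)) \<longlonglongrightarrow> x"

text \<open>The sequence of partial quotients \<open>x, c\<^sub>1, \<dots>, c\<^sub>n, c\<^sub>1, \<dots>, c\<^sub>n, \<dots>\<close>
  of the continued fraction \<open>[x, {c\<^sub>1, \<dots>, c\<^sub>n}]\<close>.\<close>

definition periodic_cf :: "nat \<Rightarrow> nat list \<Rightarrow> nat \<Rightarrow> nat" where
  "periodic_cf x cs n = (case n of 0 \<Rightarrow> x | Suc i \<Rightarrow> cs ! (i mod length cs))"

definition Z_sqrt :: "nat \<Rightarrow> real ring" where
  "Z_sqrt d = \<lparr>carrier = {of_int x + of_int y * sqrt (real d) | x y :: int. True},
     monoid.mult = (*), one = 1, zero = 0, add = (+)\<rparr>"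

lemma Z_sqrt_carrierI: "of_int x + of_int y * sqrt (real d) \<in> carrier (Z_sqrt d)"
  unfolding Z_sqrt_def by auto

lemma Z_sqrt_cring: "cring (Z_sqrt d)"
proof (rule cringI)
  have mult: "u * v \<in> carrier (Z_sqrt d)"
    if uv: "u \<in> carrier (Z_sqrt d)" "v \<in> carrier (Z_sqrt d)" for u v
  proof -
    from uv obtain x y x' y' :: int
      where "u = of_int x + of_int y * sqrt (real d)" "v = of_int x' + of_int y' * sqrt (real d)"
      unfolding Z_sqrt_def by auto
    then have "u * v = of_int (x * x' + y * y' * int d) + of_int (x * y' + y * x') * sqrt (real d)"
      by (simp add: algebra_simps)
    then show ?thesis by (simp only: Z_sqrt_carrierI)
  qed
  have add: "u + v \<in> carrier (Z_sqrt d)"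
    if uv: "u \<in> carrier (Z_sqrt d)" "v \<in> carrier (Z_sqrt d)" for u v
  proof -
    from uv obtain x y x' y' :: int
      where "u = of_int x + of_int y * sqrt (real d)" "v = of_int x' + of_int y' * sqrt (real d)"
      unfolding Z_sqrt_def by auto
    then have "u + v = of_int (x + x') + of_int (y + y') * sqrt (real d)"
      by (simp add: algebra_simps)
    then show ?thesis by (simp only: Z_sqrt_carrierI)
  qed
  have int: "of_int x \<in> carrier (Z_sqrt d)" for x
    using Z_sqrt_carrierI[of x 0 d] by simp
  show "abelian_group (Z_sqrt d)"
  proof (rule abelian_groupI)
    fix u assume u: "u \<in> carrier (Z_sqrt d)"
    have "- u \<in> carrier (Z_sqrt d)"
      using mult[OF int[of "-1"] u] by simp
    then show "\<exists>v\<in>carrier (Z_sqrt d). v \<oplus>\<^bsub>Z_sqrt d\<^esub> u = \<zero>\<^bsub>Z_sqrt d\<^esub>"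
      by (rule bexI[rotated]) (simp add: Z_sqrt_def)
  qed (use add int[of 0] in \<open>simp_all add: Z_sqrt_def\<close>)
  show "Group.comm_monoid (Z_sqrt d)"
    by (rule comm_monoidI) (use mult int[of 1] in \<open>simp_all add: Z_sqrt_def\<close>)
qed (simp add: Z_sqrt_def algebra_simps)

text \<open>The division defining \<open>D\<^sub>1 = D q\<^sup>2 / Q\<close> is exact.\<close>

lemma real_radicand:
  fixes D Q q :: nat
  assumes "Q > 0" and q: "q = (LEAST d. 0 < d \<and> d dvd Q \<and> Q dvd d\<^sup>2)"
  shows "real (D * q\<^sup>2 div Q) = real D * (real q)\<^sup>2 / real Q"
proof -
  have "0 < Q \<and> Q dvd Q \<and> Q dvd Q\<^sup>2" using assms(1) by (simp add: power2_eq_square)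
  from LeastI[of "\<lambda>d. 0 < d \<and> d dvd Q \<and> Q dvd d\<^sup>2", OF this]
  have "Q dvd q\<^sup>2" unfolding q by blast
  then have "Q dvd D * q\<^sup>2" by (rule dvd_mult)
  then show ?thesis by (simp add: real_of_nat_div)
qed

end

theory Submission
  imports Defs
begin

text \<open>
  Let \<open>w = sqrt (D / Q)\<close>, so that \<open>sqrt D\<^sub>1 = q w\<close>. A unit \<open>r + s sqrt D\<^sub>1\<close> has norm \<open>\<plusminus>1\<close>, and so
  \<open>R = r / t\<close>, \<open>S = s q / t\<close> are coprime with \<open>R\<^sup>2 - w\<^sup>2 S\<^sup>2 = \<plusminus>1 / t\<^sup>2\<close>. As \<open>w > 1\<close>, this forces
  \<open>\<bar>R / S - w\<bar> < 1 / (2 S\<^sup>2)\<close>, and Legendre's criterion applies. By periodicity,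
  \<open>r\<^bsub>k+m+1\<^esub> + s\<^bsub>k+m+1\<^esub> w = (r\<^sub>k + s\<^sub>k w) (r\<^sub>m + s\<^sub>m w)\<close>, where \<open>r\<^sub>m\<^sup>2 - w\<^sup>2 s\<^sub>m\<^sup>2 = \<plusminus>1\<close> and
  \<open>w\<^sup>2 s\<^sub>m\<close> is an integer. Hence \<open>q dvd Q dvd s\<^sub>m\<close>, so \<open>r\<^sub>m + s\<^sub>m w\<close> is itself a unit of \<open>Z[sqrt D\<^sub>1]\<close>,
  and multiplication by it preserves \<open>gcd r q\<close>.
\<close>

section \<open>Continuants\<close>

text \<open>Indices are shifted by two: the \<open>k\<close>-th convergent is \<open>cf_num a (k + 2) / cf_den a (k + 2)\<close>.\<close>

fun cf_num :: "(nat \<Rightarrow> nat) \<Rightarrow> nat \<Rightarrow> int" where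
  "cf_num a 0 = 0"
| "cf_num a (Suc 0) = 1"
| "cf_num a (Suc (Suc k)) = int (a k) * cf_num a (Suc k) + cf_num a k"

fun cf_den :: "(nat \<Rightarrow> nat) \<Rightarrow> nat \<Rightarrow> int" where
  "cf_den a 0 = 1"
| "cf_den a (Suc 0) = 0"
| "cf_den a (Suc (Suc k)) = int (a k) * cf_den a (Suc k) + cf_den a k"

text \<open>As functions of \<open>j\<close>, both sides obey the same two-term recurrence, so
  agreement at \<open>j = 0\<close> and \<open>j = 1\<close> suffices. This splits a product of the
  matrices with rows \<open>(a i, 1)\<close> and \<open>(1, 0)\<close> at position
  \<open>n\<close>.\<close>

lemma cf_num_add:
  "cf_num a (n + j) = cf_num a (Suc n) * cf_num (\<lambda>i. a (n + i)) j + cf_num a n * cf_den (\<lambda>i. a (n + i)) j"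
  by (induction j rule: induct_nat_012) (simp_all add: algebra_simps)

lemma cf_den_add:
  "cf_den a (n + j) = cf_den a (Suc n) * cf_num (\<lambda>i. a (n + i)) j + cf_den a n * cf_den (\<lambda>i. a (n + i)) j"
  by (induction j rule: induct_nat_012) (simp_all add: algebra_simps)

text \<open>Each step of the recurrence multiplies by a matrix of determinant -1.\<close>

lemma cf_det: "cf_num a (Suc j) * cf_den a j - cf_num a j * cf_den a (Suc j) = (- 1) ^ j"
  by (induction j) (simp_all add: algebra_simps)

lemma cf_coprime: "coprime (cf_num a j) (cf_den a j)"
proof (rule coprimeI)
  fix c assume "c dvd cf_num a j" "c dvd cf_den a j"
  then have "c dvd cf_num a (Suc j) * cf_den a j - cf_num a j * cf_den a (Suc j)" by simp
  then have "c dvd (- 1) ^ j" by (simp only: cf_det)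
  then show "is_unit c" by (cases "even j") simp_all
qed

lemma cf_den_pos:
  assumes "\<And>i. i > 0 \<Longrightarrow> a i > 0"
  shows "cf_den a (k + 2) > 0"
proof -
  \<comment> \<open>The recurrence looks back two places, so the preceding denominator is carried
    along; it is only nonnegative, since \<open>cf_den a 1 = 0\<close>.\<close>
  have "cf_den a (Suc (Suc k)) > 0 \<and> cf_den a (Suc k) \<ge> 0"
    by (induction k) (simp_all add: assms add_pos_nonneg)
  then show ?thesis by simp
qed

text \<open>Crude growth that leaves only finitely many denominators below a given bound, as the
  choice of a last one in Legendre's criterion requires.\<close>

lemma cf_den_ge:
  assumes "\<And>i. i > 0 \<Longrightarrow> a i > 0"
  shows "cf_den a (k + 2) \<ge> int k"
proof (induction k)
  case (Suc k)
  have pos: "cf_den a (k + 2) > 0" by (rule cf_den_pos) (rule assms)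
  have "int (a (Suc k)) \<ge> 1" using assms[of "Suc k"] by simp
  then have "int (a (Suc k)) * cf_den a (k + 2) \<ge> 1 * cf_den a (k + 2)"
    using pos by (intro mult_right_mono) simp_all
  \<comment> \<open>For \<open>k = 0\<close> this term is \<open>cf_den a 1 = 0\<close> and nothing
    is gained, but there positivity of \<open>cf_den a 2\<close> already gives the bound.\<close>
  moreover have "cf_den a (Suc k) \<ge> (if k = 0 then 0 else 1)"
    using cf_den_pos[of a "k - 1"] assms by (cases k) simp_all
  moreover have "cf_den a (Suc k + 2) = int (a (Suc k)) * cf_den a (k + 2) + cf_den a (Suc k)"
    by simp
  ultimately have "cf_den a (Suc k + 2) \<ge> cf_den a (k + 2) + (if k = 0 then 0 else 1)"
    by linarith
  then show ?case using Suc pos by (simp del: cf_den.simps(3) split: if_splits)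
qed simp

declare cf_num.simps(3) [simp del] cf_den.simps(3) [simp del]

lemma cf_num_2 [simp]: "cf_num a (Suc (Suc 0)) = int (a 0)"
  by (simp add: cf_num.simps)

lemma cf_den_2 [simp]: "cf_den a (Suc (Suc 0)) = 1"
  by (simp add: cf_den.simps)

text \<open>In the recurrence for denominators the leading partial quotient is multiplied by
  \<open>cf_den a 1 = 0\<close>.\<close>

lemma cf_den_add_head:
  assumes "\<And>i. i > 0 \<Longrightarrow> a' i = a i"
  shows "cf_den a' (Suc j) = cf_den a (Suc j)"
proof (induction j rule: induct_nat_012)
  case (ge2 j)
  then show ?case by (simp add: assms cf_den.simps(3)[of _ "Suc j"])
qed simp_all

text \<open>Raising the leading term by \<open>c\<close> raises every convergent by
  \<open>c\<close>. Index 0 has to be left out: there both numerators are 0 while the denominator is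
  1.\<close>

lemma cf_num_add_head:
  assumes "\<And>i. i > 0 \<Longrightarrow> a' i = a i" and "a' 0 = a 0 + c"
  shows "cf_num a' (Suc j) = cf_num a (Suc j) + int c * cf_den a (Suc j)"
proof (induction j rule: induct_nat_012)
  case (ge2 j)
  then show ?case
    by (simp add: assms(1) cf_num.simps(3)[of _ "Suc j"] cf_den.simps(3)[of _ "Suc j"] algebra_simps)
qed (simp_all add: assms)

lemma cf_value_continuants:
  assumes "\<And>i. i > 0 \<Longrightarrow> a i > 0"
  shows "cf_value a k = of_int (cf_num a (k + 2)) / of_int (cf_den a (k + 2))"
  using assms
proof (induction k arbitrary: a)
  case 0
  then show ?case by (simp add: cf_value_def)
next
  case (Suc k)
  define a' where "a' = (\<lambda>i. a (Suc i))"
  \<comment> \<open>Splitting off one term is the continuant form of \<open>a 0 + 1 / y\<close>: the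
    numerators of the tail become the denominators of the whole.\<close>
  have num: "cf_num a (Suc j) = int (a 0) * cf_num a' j + cf_den a' j" for j
    using cf_num_add[of a 1 j] by (simp add: a'_def)
  have den: "cf_den a (Suc j) = cf_num a' j" for j
    using cf_den_add[of a 1 j] by (simp add: a'_def)
  have pos: "cf_num a' (k + 2) > 0"
    using cf_den_pos[of a "Suc k"] Suc.prems by (simp add: den)
  have list: "map a [0..<Suc (Suc k)] = a 0 # map a' [0..<Suc k]"
    by (subst upt_conv_Cons, simp, subst map_Suc_upt[symmetric]) (simp add: a'_def)
  have ne: "map a' [0..<Suc k] \<noteq> []" by simp
  then have cons: "finite_cf (a 0 # map a' [0..<Suc k]) = of_nat (a 0) + 1 / finite_cf (map a' [0..<Suc k])"
    by (cases "map a' [0..<Suc k]") (simp_all del: upt_Suc)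
  have "cf_value a (Suc k) = of_nat (a 0) + 1 / cf_value a' k"
    unfolding cf_value_def list cons ..
  also have "cf_value a' k = of_int (cf_num a' (k + 2)) / of_int (cf_den a' (k + 2))"
    by (rule Suc.IH) (simp add: a'_def Suc.prems)
  also have "of_nat (a 0) + 1 / \<dots> = (of_int (cf_num a (Suc (k + 2))) / of_int (cf_den a (Suc (k + 2))) :: rat)"
    using pos unfolding num den by (simp add: divide_simps)
  finally show ?case by simp
qed

text \<open>Continuants are coprime with positive denominator, hence already in the normal form that
  \<open>quotient_of\<close> returns.\<close>

lemma cf_convergent_continuants:
  assumes "\<And>i. i > 0 \<Longrightarrow> a i > 0"
  shows "cf_convergent a k = (cf_num a (k + 2), cf_den a (k + 2))"
proof -
  have "cf_convergent a k = quotient_of (Fract (cf_num a (k + 2)) (cf_den a (k + 2)))"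
    unfolding cf_convergent_def by (subst cf_value_continuants) (simp_all add: assms Fract_of_int_quotient)
  also have "\<dots> = (cf_num a (k + 2), cf_den a (k + 2))"
    by (simp only: quotient_of_Fract normalize_stable cf_den_pos assms cf_coprime)
  finally show ?thesis .
qed

section \<open>Legendre's criterion\<close>

lemma simple_cf_of_tendsto:
  assumes "simple_cf_of a x"
  shows "(\<lambda>k. of_int (cf_num a (k + 2)) / of_int (cf_den a (k + 2))) \<longlonglongrightarrow> x"
proof -
  have "of_rat (cf_value a k) = (of_int (cf_num a (k + 2)) / of_int (cf_den a (k + 2)) :: real)" for k
    using assms by (subst cf_value_continuants) (simp_all add: simple_cf_of_def of_rat_divide)
  then show ?thesis using assms by (simp add: simple_cf_of_def)
qed

text \<open>Convergents of even index increase to \<open>x\<close>, those of odd index decrease to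
  it; the factor \<open>(- 1) ^ k\<close> treats both cases at once.\<close>

lemma convergent_error_sign:
  assumes cf: "simple_cf_of a x"
  shows "(- 1) ^ k * (of_int (cf_num a (k + 2)) - x * of_int (cf_den a (k + 2))) \<le> 0"
proof -
  define c :: "nat \<Rightarrow> real" where "c k = of_int (cf_num a (k + 2)) / of_int (cf_den a (k + 2))" for k
  have pos: "cf_den a (k + 2) > 0" for k
    using cf cf_den_pos by (simp add: simple_cf_of_def)
  have step: "(- 1) ^ k * c k \<le> (- 1) ^ k * c (k + 2)" for k
  proof -
    \<comment> \<open>One use of the recurrence turns the determinant of convergents two apart into
      a partial quotient times that of neighbours.\<close>
    have "cf_num a (k + 2 + 2) * cf_den a (k + 2) - cf_num a (k + 2) * cf_den a (k + 2 + 2)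
        = int (a (k + 2)) * (cf_num a (Suc (k + 2)) * cf_den a (k + 2) - cf_num a (k + 2) * cf_den a (Suc (k + 2)))"
      by (simp add: cf_num.simps cf_den.simps algebra_simps)
    also have "\<dots> = int (a (k + 2)) * (- 1) ^ k"
      unfolding cf_det by simp
    finally have "(- 1) ^ k * (cf_num a (k + 2 + 2) * cf_den a (k + 2) - cf_num a (k + 2) * cf_den a (k + 2 + 2)) = int (a (k + 2))"
      by (simp add: mult.left_commute flip: power_mult_distrib)
    then have "0 \<le> (- 1) ^ k * (cf_num a (k + 2 + 2) * cf_den a (k + 2) - cf_num a (k + 2) * cf_den a (k + 2 + 2))"
      by simp
    then have "0 \<le> (of_int ((- 1) ^ k * (cf_num a (k + 2 + 2) * cf_den a (k + 2) - cf_num a (k + 2) * cf_den a (k + 2 + 2))) :: real)"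
      by (simp only: of_int_0_le_iff)
    moreover have "(- 1) ^ k * c (k + 2) - (- 1) ^ k * c k
        = of_int ((- 1) ^ k * (cf_num a (k + 2 + 2) * cf_den a (k + 2) - cf_num a (k + 2) * cf_den a (k + 2 + 2)))
          / (of_int (cf_den a (k + 2 + 2)) * of_int (cf_den a (k + 2)))"
      using pos[of k] pos[of "k + 2"] unfolding c_def
      by (simp add: field_simps)
    ultimately have "(- 1) ^ k * c (k + 2) - (- 1) ^ k * c k \<ge> 0"
      using pos[of k] pos[of "k + 2"] by (simp)
    then show ?thesis by simp
  qed
  have "incseq (\<lambda>n. (- 1) ^ k * c (k + 2 * n))"
  proof (rule incseq_SucI)
    fix n
    show "(- 1) ^ k * c (k + 2 * n) \<le> (- 1) ^ k * c (k + 2 * Suc n)"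
      using step[of "k + 2 * n"] by (simp add: power_add power_mult)
  qed
  moreover have "(\<lambda>n. (- 1) ^ k * c (k + 2 * n)) \<longlonglongrightarrow> (- 1) ^ k * x"
  proof (rule tendsto_mult[OF tendsto_const])
    have "strict_mono (\<lambda>n::nat. k + 2 * n)" by (rule strict_monoI) simp
    with simple_cf_of_tendsto[OF cf] show "(\<lambda>n. c (k + 2 * n)) \<longlonglongrightarrow> x"
      unfolding c_def by (rule LIMSEQ_subseq_LIMSEQ[unfolded o_def])
  qed
  ultimately have "(- 1) ^ k * c (k + 2 * 0) \<le> (- 1) ^ k * x"
    by (rule incseq_le)
  then have "(- 1) ^ k * (c k - x) \<le> 0" by (simp add: algebra_simps)
  then have "(- 1) ^ k * (c k - x) * of_int (cf_den a (k + 2)) \<le> 0"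
    by (rule mult_nonpos_nonneg) (use pos[of k] in simp)
  moreover have "(c k - x) * of_int (cf_den a (k + 2)) = of_int (cf_num a (k + 2)) - x * of_int (cf_den a (k + 2))"
    using pos[of k] by (simp add: c_def left_diff_distrib)
  ultimately show ?thesis by (simp only: mult.assoc)
qed

text \<open>Lagrange's law of best approximation. Two consecutive convergents form a basis of the
  integer lattice; in this basis \<open>(R, S)\<close> has coefficients of opposite sign, and the
  errors of the two convergents have opposite signs too, so nothing cancels.\<close>

lemma convergent_best_approximation:
  fixes R S :: int
  assumes cf: "simple_cf_of a x" and S: "0 < S" "S < cf_den a (Suc (k + 2))"
  shows "\<bar>of_int (cf_num a (k + 2)) - x * of_int (cf_den a (k + 2))\<bar> \<le> \<bar>of_int R - x * of_int S\<bar>"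
proof -
  define p q p' q' where "p = cf_num a (k + 2)" and "q = cf_den a (k + 2)"
    and "p' = cf_num a (Suc (k + 2))" and "q' = cf_den a (Suc (k + 2))"
  define \<sigma> :: int where "\<sigma> = (- 1) ^ k"
  have \<sigma>: "\<sigma> * \<sigma> = 1" "\<sigma> = 1 \<or> \<sigma> = -1"
    by (simp_all add: \<sigma>_def flip: power_mult_distrib) (cases "even k"; simp)
  have det: "p' * q - p * q' = \<sigma>"
    using cf_det[of a "k + 2"] by (simp add: p_def q_def p'_def q'_def \<sigma>_def)
  have pos: "q > 0" "q' > 0"
    using cf cf_den_pos[of a k] cf_den_pos[of a "Suc k"] by (simp_all add: simple_cf_of_def q_def q'_def)
  define u v where "u = \<sigma> * (S * p' - R * q')" and "v = \<sigma> * (R * q - S * p)"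
  have "u * p + v * p' = \<sigma> * R * (p' * q - p * q')" "u * q + v * q' = \<sigma> * S * (p' * q - p * q')"
    by (simp_all add: u_def v_def algebra_simps)
  then have R: "R = u * p + v * p'" and Seq: "S = u * q + v * q'"
    unfolding det using \<sigma>(1) by (simp_all add: algebra_simps)
  define e e' where "e = of_int p - x * of_int q" and "e' = of_int p' - x * of_int q'"
  have e: "of_int \<sigma> * e \<le> 0" "of_int \<sigma> * e' \<ge> 0"
    using convergent_error_sign[OF cf, of k] convergent_error_sign[OF cf, of "Suc k"]
    by (simp_all add: e_def e'_def p_def q_def p'_def q'_def \<sigma>_def)
  have eq: "of_int R - x * of_int S = of_int u * e + of_int v * e'"
    by (simp add: R Seq e_def e'_def algebra_simps)
  \<comment> \<open>If \<open>v <= 0\<close>, then \<open>u q = S - v q' > 0\<close>; if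
    \<open>v > 0\<close>, then \<open>u q = S - v q' < 0\<close> because
    \<open>S < q'\<close>.\<close>
  have uv: "u \<ge> 1 \<and> v \<le> 0 \<or> u \<le> -1 \<and> v \<ge> 0"
  proof (cases "v \<le> 0")
    case True
    then have "v * q' \<le> 0" using pos by (simp add: mult_nonpos_nonneg)
    then have "u * q > 0" using Seq S by simp
    then show ?thesis using True pos by (simp add: zero_less_mult_iff)
  next
    case False
    then have "v * q' \<ge> 1 * q'" using pos by (intro mult_right_mono) simp_all
    moreover have "u * q = S - v * q'" "S < q'" using Seq S by (simp_all add: q'_def)
    ultimately have "u * q < 0" by linarith
    then show ?thesis using False pos by (simp add: mult_less_0_iff)
  qed
  have "\<bar>e\<bar> \<le> \<bar>of_int u * e + of_int v * e'\<bar>"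
  proof -
    have "\<bar>of_int u * e + of_int v * e'\<bar> = \<bar>of_int u * e\<bar> + \<bar>of_int v * e'\<bar>"
    proof -
      have "0 \<le> (of_int u * e) * (of_int v * e')"
      proof -
        have "of_int u * of_int v \<le> (0::real)" using uv
          by (auto simp: mult_le_0_iff)
        moreover have "e * e' \<le> 0"
          using e \<sigma>(2) by (auto simp: mult_le_0_iff)
        ultimately have "0 \<le> (of_int u * of_int v) * (e * e')" by (rule mult_nonpos_nonpos)
        then show ?thesis by (simp add: algebra_simps)
      qed
      moreover have "\<bar>y + z\<bar> = \<bar>y\<bar> + \<bar>z\<bar>" if "0 \<le> y * z" for y z :: real
        using that by (auto simp: zero_le_mult_iff)
      ultimately show ?thesis by blast
    qed
    moreover have "1 * \<bar>e\<bar> \<le> \<bar>of_int u\<bar> * \<bar>e\<bar>"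
      using uv by (intro mult_right_mono) auto
    ultimately show ?thesis by (simp add: abs_mult add_increasing2)
  qed
  then show ?thesis by (simp add: eq) (simp add: e_def p_def q_def)
qed

theorem legendre_criterion:
  fixes R S :: int
  assumes cf: "simple_cf_of a x" and S: "0 < S" and cop: "coprime R S"
    and close: "\<bar>of_int R - x * of_int S\<bar> * (2 * of_int S) < 1"
  shows "\<exists>k. (R, S) = cf_convergent a k"
proof -
  have a: "\<And>i. i > 0 \<Longrightarrow> a i > 0" using cf by (simp add: simple_cf_of_def)
  \<comment> \<open>The last convergent whose denominator does not exceed \<open>S\<close>. Taking
    the greatest index settles the possible tie \<open>cf_den a 2 = cf_den a 3 = 1\<close>.\<close>
  define k where "k = (GREATEST k. cf_den a (k + 2) \<le> S)"
  have bound: "\<forall>k. cf_den a (k + 2) \<le> S \<longrightarrow> k \<le> nat S"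
  proof (intro allI impI)
    fix k assume "cf_den a (k + 2) \<le> S"
    with cf_den_ge[of a k] a have "int k \<le> S" by simp
    then show "k \<le> nat S" by simp
  qed
  have k: "cf_den a (k + 2) \<le> S"
    unfolding k_def by (rule GreatestI_nat[of _ 0 "nat S"]) (use S bound in simp_all)
  have k': "S < cf_den a (Suc (k + 2))"
  proof (rule ccontr)
    assume "\<not> ?thesis"
    then have "cf_den a (Suc k + 2) \<le> S" by simp
    then have "Suc k \<le> k"
      unfolding k_def by (rule Greatest_le_nat) (use bound in auto)
    then show False by simp
  qed
  define p q where "p = cf_num a (k + 2)" and "q = cf_den a (k + 2)"
  have q: "0 < q" "q \<le> S" using cf_den_pos[OF a] k by (simp_all add: q_def)
  have best: "\<bar>of_int p - x * of_int q\<bar> \<le> \<bar>of_int R - x * of_int S\<bar>"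
    unfolding p_def q_def by (rule convergent_best_approximation[OF cf S k'])
  \<comment> \<open>The integer \<open>R q - S p\<close> combines two errors, each at most
    \<open>\<bar>R - x S\<bar>\<close>, with weights at most \<open>S\<close>. So it is below 1 in
    absolute value and vanishes.\<close>
  have "real_of_int \<bar>R * q - S * p\<bar> = \<bar>(of_int R - x * of_int S) * of_int q - (of_int p - x * of_int q) * of_int S\<bar>"
    by (simp add: algebra_simps)
  also have "\<dots> \<le> \<bar>of_int R - x * of_int S\<bar> * of_int q + \<bar>of_int p - x * of_int q\<bar> * of_int S"
    using q S by (intro order.trans[OF abs_triangle_ineq4]) (simp add: abs_mult)
  also have "\<dots> \<le> \<bar>of_int R - x * of_int S\<bar> * of_int S + \<bar>of_int R - x * of_int S\<bar> * of_int S"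
    using q S best by (intro add_mono mult_left_mono mult_right_mono) simp_all
  also have "\<dots> < 1" using close by (simp add: algebra_simps)
  finally have "R * q = S * p" by linarith
  moreover have "coprime p q" unfolding p_def q_def by (rule cf_coprime)
  moreover have "\<bar>R\<bar> * \<bar>q\<bar> = \<bar>p\<bar> * \<bar>S\<bar>"
    using \<open>R * q = S * p\<close> by (simp add: mult.commute flip: abs_mult)
  ultimately have "S = q"
    using q S coprime_crossproduct_int[OF cop, of p q] by simp
  with \<open>R * q = S * p\<close> have "R = p \<and> S = q" using S by simp
  then show ?thesis
    using cf_convergent_continuants[OF a] by (auto simp: p_def q_def)
qed

section \<open>Periodic expansions of square roots\<close>

lemma irrational_linear_eq:
  fixes x :: real
  assumes "x \<notin> \<rat>" "u \<in> \<rat>" "v \<in> \<rat>" "u + v * x = 0"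
  shows "u = 0" "v = 0"
proof -
  show "v = 0"
  proof (rule ccontr)
    assume "v \<noteq> 0"
    then have "x = - u / v" using assms(4) by (simp add: field_simps)
    then show False using assms by simp
  qed
  then show "u = 0" using assms(4) by simp
qed

context
  fixes a :: "nat \<Rightarrow> nat" and x :: real and n :: nat
  assumes cf: "simple_cf_of a x"
    and period: "\<And>i. i > 0 \<Longrightarrow> a (n + i) = a i" "a n = 2 * a 0"
    and irrational: "x \<notin> \<rat>" and square: "x\<^sup>2 \<in> \<rat>"
begin

text \<open>From index \<open>n\<close> on, the sequence is \<open>a\<close> itself with its leading
  term raised by \<open>a 0\<close>.\<close>

lemma periodic_tail:
  shows "cf_num (\<lambda>i. a (n + i)) (Suc j) = cf_num a (Suc j) + int (a 0) * cf_den a (Suc j)"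
    and "cf_den (\<lambda>i. a (n + i)) (Suc j) = cf_den a (Suc j)"
proof -
  show "cf_num (\<lambda>i. a (n + i)) (Suc j) = cf_num a (Suc j) + int (a 0) * cf_den a (Suc j)"
    by (rule cf_num_add_head) (simp_all add: period)
  show "cf_den (\<lambda>i. a (n + i)) (Suc j) = cf_den a (Suc j)"
    by (rule cf_den_add_head) (simp add: period)
qed

lemma periodic_num:
  "cf_num a (n + Suc j) = cf_num a (Suc n) * cf_num a (Suc j)
     + (cf_num a (Suc n) * int (a 0) + cf_num a n) * cf_den a (Suc j)"
  unfolding cf_num_add periodic_tail by (simp add: algebra_simps)

lemma periodic_den:
  "cf_den a (n + Suc j) = cf_den a (Suc n) * cf_num a (Suc j)
     + (cf_den a (Suc n) * int (a 0) + cf_den a n) * cf_den a (Suc j)"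
  unfolding cf_den_add periodic_tail by (simp add: algebra_simps)

text \<open>A shift by one period acts on convergents by a Moebius map, which therefore fixes the
  limit \<open>x\<close>. Comparing rational and irrational parts of the fixed point equation shows
  that its matrix is that of multiplication by \<open>P + Q x\<close> on pairs
  \<open>u + v x\<close>.\<close>

lemma periodic_fixed_point:
  shows "cf_num a (Suc n) = cf_den a (Suc n) * int (a 0) + cf_den a n"
    and "of_int (cf_num a (Suc n) * int (a 0) + cf_num a n) = x\<^sup>2 * of_int (cf_den a (Suc n))"
proof -
  define P P' Q Q' where "P = cf_num a (Suc n)" and "P' = cf_num a (Suc n) * int (a 0) + cf_num a n"
    and "Q = cf_den a (Suc n)" and "Q' = cf_den a (Suc n) * int (a 0) + cf_den a n"
  define c :: "nat \<Rightarrow> real" where "c k = of_int (cf_num a (k + 2)) / of_int (cf_den a (k + 2))" for k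
  have pos: "cf_den a (k + 2) > 0" for k
    using cf cf_den_pos by (simp add: simple_cf_of_def)
  have lim: "c \<longlonglongrightarrow> x" unfolding c_def by (rule simple_cf_of_tendsto[OF cf])
  \<comment> \<open>The Moebius relation is cleared of its denominator, so that no nonvanishing has
    to be checked in the limit.\<close>
  have "c (n + k) * (of_int Q * c k + of_int Q') = of_int P * c k + of_int P'" for k
  proof -
    have num: "cf_num a (n + k + 2) = P * cf_num a (k + 2) + P' * cf_den a (k + 2)"
      using periodic_num[of "Suc k"] by (simp add: P_def P'_def)
    have den: "cf_den a (n + k + 2) = Q * cf_num a (k + 2) + Q' * cf_den a (k + 2)"
      using periodic_den[of "Suc k"] by (simp add: Q_def Q'_def)
    have "of_int Q * c k + of_int Q' = of_int (cf_den a (n + k + 2)) / of_int (cf_den a (k + 2))"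
      using pos[of k] unfolding den c_def by (simp add: field_simps)
    moreover have "of_int P * c k + of_int P' = of_int (cf_num a (n + k + 2)) / of_int (cf_den a (k + 2))"
      using pos[of k] unfolding num c_def by (simp add: field_simps)
    ultimately show ?thesis
      using pos[of "n + k"] by (simp add: c_def)
  qed
  moreover have "(\<lambda>k. c (n + k) * (of_int Q * c k + of_int Q')) \<longlonglongrightarrow> x * (of_int Q * x + of_int Q')"
    using lim LIMSEQ_ignore_initial_segment[OF lim, of n]
    by (intro tendsto_intros) (simp_all add: add.commute)
  moreover have "(\<lambda>k. of_int P * c k + of_int P') \<longlonglongrightarrow> of_int P * x + of_int P'"
    by (intro tendsto_intros lim)
  ultimately have "x * (of_int Q * x + of_int Q') = of_int P * x + of_int P'"
    by (simp add: LIMSEQ_unique)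
  then have "(of_int P' - x\<^sup>2 * of_int Q) + of_int (P - Q') * x = 0"
    by (simp add: algebra_simps power2_eq_square)
  from irrational_linear_eq[OF irrational _ _ this] square
  have "of_int P' - x\<^sup>2 * of_int Q = 0" "real_of_int (P - Q') = 0"
    by simp_all
  then have "of_int P' = x\<^sup>2 * of_int Q" "P = Q'" by simp_all
  then show "cf_num a (Suc n) = cf_den a (Suc n) * int (a 0) + cf_den a n"
    "of_int (cf_num a (Suc n) * int (a 0) + cf_num a n) = x\<^sup>2 * of_int (cf_den a (Suc n))"
    by (simp_all add: P_def P'_def Q_def Q'_def)
qed

lemma periodic_shift_den:
  "cf_den a (n + Suc j) = cf_den a (Suc n) * cf_num a (Suc j) + cf_num a (Suc n) * cf_den a (Suc j)"
  unfolding periodic_den periodic_fixed_point(1)[symmetric] ..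

text \<open>The norm of \<open>P + Q x\<close> is the determinant of the shift matrix; adding
  \<open>a 0\<close> times the first column to the second leaves the determinant of
  \<open>cf_det\<close> unchanged.\<close>

lemma periodic_norm:
  "(of_int (cf_num a (Suc n)))\<^sup>2 - x\<^sup>2 * (of_int (cf_den a (Suc n)))\<^sup>2 = (- 1) ^ n"
proof -
  define P Q where "P = cf_num a (Suc n)" and "Q = cf_den a (Suc n)"
  have "(of_int P)\<^sup>2 - x\<^sup>2 * (of_int Q)\<^sup>2 = of_int (P * P) - (x\<^sup>2 * of_int Q) * of_int Q"
    by (simp add: power2_eq_square)
  also have "\<dots> = of_int (P * (Q * int (a 0) + cf_den a n) - (P * int (a 0) + cf_num a n) * Q)"
    using periodic_fixed_point unfolding P_def Q_def by (metis of_int_diff of_int_mult)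
  also have "P * (Q * int (a 0) + cf_den a n) - (P * int (a 0) + cf_num a n) * Q = (- 1) ^ n"
    using cf_det[of a n] by (simp add: P_def Q_def algebra_simps)
  finally show ?thesis by (simp add: P_def Q_def)
qed

end

section \<open>The head and the period of \<open>periodic_cf\<close>\<close>

lemma periodic_cf_0: "periodic_cf x cs 0 = x"
  by (simp add: periodic_cf_def)

lemma periodic_cf_add_length:
  assumes "i > 0"
  shows "periodic_cf x cs (length cs + i) = periodic_cf x cs i"
  using assms by (cases i) (simp_all add: periodic_cf_def)

lemma periodic_cf_length:
  assumes "cs \<noteq> []"
  shows "periodic_cf x cs (length cs) = last cs"
proof (cases "length cs")
  case 0
  with assms show ?thesis by simp
next
  case (Suc l)
  with assms show ?thesis by (simp add: periodic_cf_def last_conv_nth)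
qed

section \<open>Units of quadratic rings\<close>

lemma Z_sqrt_UnitsI:
  assumes "r\<^sup>2 - int d * s\<^sup>2 = e" and "\<bar>e\<bar> = 1"
  shows "of_int r + of_int s * sqrt (real d) \<in> Units (Z_sqrt d)"
proof -
  \<comment> \<open>The inverse \<open>v\<close> is the conjugate of \<open>u\<close> times its norm
    \<open>e\<close>, as \<open>e * e = 1\<close>.\<close>
  define u v where "u = of_int r + of_int s * sqrt (real d)"
    and "v = of_int (e * r) + of_int (- (e * s)) * sqrt (real d)"
  have "u * v = of_int e * of_int (r\<^sup>2 - int d * s\<^sup>2)"
    by (simp add: u_def v_def algebra_simps power2_eq_square)
  also have "\<dots> = 1" using assms by (auto simp: abs_if split: if_splits)
  finally have "u * v = 1" .
  then have "v \<otimes>\<^bsub>Z_sqrt d\<^esub> u = \<one>\<^bsub>Z_sqrt d\<^esub>" "u \<otimes>\<^bsub>Z_sqrt d\<^esub> v = \<one>\<^bsub>Z_sqrt d\<^esub>"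
    by (simp_all add: Z_sqrt_def mult.commute)
  moreover have "u \<in> carrier (Z_sqrt d)" "v \<in> carrier (Z_sqrt d)"
    unfolding u_def v_def by (rule Z_sqrt_carrierI)+
  ultimately have "u \<in> Units (Z_sqrt d)"
    unfolding Units_def by blast
  then show ?thesis by (simp add: u_def)
qed

lemma Z_sqrt_Units_norm:
  assumes irr: "sqrt (real d) \<notin> \<rat>"
    and unit: "of_int r + of_int s * sqrt (real d) \<in> Units (Z_sqrt d)"
  shows "\<bar>r\<^sup>2 - int d * s\<^sup>2\<bar> = 1"
proof -
  obtain x y :: int where
    "(of_int x + of_int y * sqrt (real d)) * (of_int r + of_int s * sqrt (real d)) = 1"
    using unit unfolding Units_def by (auto simp: Z_sqrt_def)
  then have "of_int (x * r + int d * y * s - 1) + of_int (x * s + y * r) * sqrt (real d) = 0"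
    by (simp add: algebra_simps)
  from irrational_linear_eq[OF irr _ _ this]
  have "real_of_int (x * r + int d * y * s - 1) = 0" "real_of_int (x * s + y * r) = 0"
    by simp_all
  then have xy: "x * r + int d * y * s = 1" "x * s + y * r = 0"
    by (simp_all only: of_int_eq_0_iff)
  \<comment> \<open>Brahmagupta's identity: norms multiply, so the two integer norms have product
    1.\<close>
  have "(r\<^sup>2 - int d * s\<^sup>2) * (x\<^sup>2 - int d * y\<^sup>2) = (x * r + int d * y * s)\<^sup>2 - int d * (x * s + y * r)\<^sup>2"
    by (simp add: algebra_simps power2_eq_square)
  also have "\<dots> = 1" using xy by simp
  finally show ?thesis using zmult_eq_1_iff by fastforce
qed

text \<open>The conjugate \<open>z\<close> of \<open>y > 1\<close> satisfies
  \<open>\<bar>z\<bar> = 1 / y < y\<close>, so \<open>y + z\<close> and \<open>y - z\<close> are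
  both positive.\<close>

lemma unit_gt_1_components_pos:
  fixes r s :: int
  assumes norm: "\<bar>r\<^sup>2 - int d * s\<^sup>2\<bar> = 1"
    and gt: "of_int r + of_int s * sqrt (real d) > 1"
  shows "r > 0" "s > 0"
proof -
  define y z where "y = of_int r + of_int s * sqrt (real d)" and "z = of_int r - of_int s * sqrt (real d)"
  have "y * z = of_int (r\<^sup>2 - int d * s\<^sup>2)"
    by (simp add: y_def z_def algebra_simps power2_eq_square)
  then have "\<bar>y\<bar> * \<bar>z\<bar> = 1" using norm by (metis abs_mult of_int_abs of_int_1)
  moreover have y: "y > 1" using gt by (simp add: y_def)
  ultimately have "\<bar>z\<bar> = 1 / y" by (simp add: field_simps)
  then have z: "\<bar>z\<bar> < y" using y by (simp add: divide_less_eq) (use y less_1_mult in blast)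
  have "2 * of_int r = y + z" "2 * (of_int s * sqrt (real d)) = y - z"
    by (simp_all add: y_def z_def)
  then have "of_int r > (0::real)" "of_int s * sqrt (real d) > 0" using z by linarith+
  then show "r > 0" "s > 0"
    by (simp_all add: zero_less_mult_iff)
qed

text \<open>If \<open>R + 1 <= S\<close>, then
  \<open>w^2 S^2 - R^2 >= S^2 - R^2 >= 2 R + 1 > 1\<close>.\<close>

lemma ge_of_square_close:
  fixes R S :: int and w :: real
  assumes pos: "0 < R" "0 < S" and w: "1 < w"
    and close: "\<bar>(of_int R)\<^sup>2 - w\<^sup>2 * (of_int S)\<^sup>2\<bar> \<le> 1"
  shows "S \<le> R"
proof (rule ccontr)
  assume "\<not> S \<le> R"
  then have "of_int R + 1 \<le> real_of_int S" by linarith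
  then have "(of_int R + 1)\<^sup>2 \<le> (real_of_int S)\<^sup>2" using pos by (intro power_mono) simp_all
  moreover have "1 * (real_of_int S)\<^sup>2 \<le> w\<^sup>2 * (of_int S)\<^sup>2"
    using w by (intro mult_right_mono) simp_all
  moreover have "0 < real_of_int R" using pos by simp
  ultimately show False using close by (simp add: power2_sum abs_le_iff)
qed

text \<open>The difference of squares has the factor \<open>R + w S\<close>, which exceeds
  \<open>2 S\<close> because \<open>R >= S\<close> and \<open>w > 1\<close>. Equality
  \<open>R = w S\<close> is treated apart, as the strict estimate multiplies by
  \<open>\<bar>R - w S\<bar>\<close>.\<close>

lemma square_close_imp_legendre:
  fixes R S :: int and w :: real
  assumes pos: "0 < R" "0 < S" and w: "1 < w"
    and close: "\<bar>(of_int R)\<^sup>2 - w\<^sup>2 * (of_int S)\<^sup>2\<bar> \<le> 1"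
  shows "\<bar>of_int R - w * of_int S\<bar> * (2 * of_int S) < 1"
proof (cases "of_int R = w * of_int S")
  case False
  have "S \<le> R" by (rule ge_of_square_close[OF pos w close])
  moreover have "1 * real_of_int S < w * of_int S" using pos w by (intro mult_strict_right_mono) simp_all
  ultimately have "2 * of_int S < of_int R + w * of_int S" by linarith
  then have "\<bar>of_int R - w * of_int S\<bar> * (2 * of_int S) < \<bar>of_int R - w * of_int S\<bar> * (of_int R + w * of_int S)"
    using False by (intro mult_strict_left_mono) simp_all
  also have "\<dots> = \<bar>(of_int R - w * of_int S) * (of_int R + w * of_int S)\<bar>"
    using pos w by (simp add: abs_mult)
  also have "(of_int R - w * of_int S) * (of_int R + w * of_int S) = (of_int R)\<^sup>2 - w\<^sup>2 * (of_int S)\<^sup>2"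
    by (simp add: algebra_simps power2_eq_square)
  finally show ?thesis using close by simp
qed simp

section \<open>Convergents that come from units of \<open>Z_sqrt D1\<close>\<close>

theorem theorem1:
  fixes D Q q D1 m :: nat and b a :: "nat \<Rightarrow> nat" and r s t :: int
  assumes "0 < D" and "0 < Q" and "coprime D Q"
    and "real D / real Q > 1"
    and "\<not> (\<exists>x :: rat. x\<^sup>2 = of_nat D / of_nat Q)"
    and "q = (LEAST d. 0 < d \<and> d dvd Q \<and> Q dvd d\<^sup>2)"
    and "D1 = D * q\<^sup>2 div Q"
    and "\<forall>i\<le>m. 0 < b i"
    and "a = periodic_cf (b 0) (map b [1..<Suc m] @ [2 * b 0])"
    and "simple_cf_of a (sqrt (real D / real Q))"
    and "of_int r + of_int s * sqrt (real D1) \<in> Units (Z_sqrt D1)"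
    and "of_int r + of_int s * sqrt (real D1) > 1"
    and "t = gcd r (int q)"
  shows "(\<exists>k. (r div t, s * int q div t) = cf_convergent a k) \<and>
    (\<forall>k. (r div t, s * int q div t) = cf_convergent a k \<longrightarrow>
      (\<exists>r' s' :: int.
         of_int r' + of_int s' * sqrt (real D1) \<in> Units (Z_sqrt D1) \<and>
         of_int r' + of_int s' * sqrt (real D1) \<noteq> of_int r + of_int s * sqrt (real D1) \<and>
         cf_convergent a (k + m + 1) = (r' div t, s' * int q div t) \<and>
         gcd r' (int q) = t))"
proof -
  define w where "w = sqrt (real D / real Q)"
  have w1: "w > 1" using assms(4) by (simp add: w_def)
  have w2: "w\<^sup>2 = real D / real Q" by (simp add: w_def)
  have irr: "w \<notin> \<rat>"
  proof
    assume "w \<in> \<rat>"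
    then obtain y where "w = of_rat y" by (auto elim: Rats_cases)
    then have "of_rat (y\<^sup>2) = (of_rat (of_nat D / of_nat Q) :: real)"
      using w2 by (simp add: of_rat_power of_rat_divide)
    then show False using assms(5) by (simp only: of_rat_eq_iff) blast
  qed
  \<comment> \<open>\<open>Q\<close> is itself a candidate, so the least one exists.\<close>
  have "0 < q \<and> q dvd Q \<and> Q dvd q\<^sup>2"
    unfolding assms(6)
    by (rule LeastI[of "\<lambda>d. 0 < d \<and> d dvd Q \<and> Q dvd d\<^sup>2" Q])
      (use assms(2) in \<open>simp add: power2_eq_square\<close>)
  then have q: "0 < q" "q dvd Q" by simp_all
  have D1: "real D1 = w\<^sup>2 * (real q)\<^sup>2"
    unfolding assms(7) real_radicand[OF assms(2,6)] w2 by simp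
  then have sqrtD1: "sqrt (real D1) = w * real q"
    using w1 by (simp add: real_sqrt_mult)
  have irrD1: "sqrt (real D1) \<notin> \<rat>"
  proof
    assume "sqrt (real D1) \<in> \<rat>"
    then have "sqrt (real D1) / real q \<in> \<rat>" by simp
    then show False using irr q by (simp add: sqrtD1)
  qed
  have norm: "\<bar>r\<^sup>2 - int D1 * s\<^sup>2\<bar> = 1"
    by (rule Z_sqrt_Units_norm[OF irrD1 assms(11)])
  have r: "r > 0" and s: "s > 0"
    using unit_gt_1_components_pos[OF norm assms(12)] by simp_all
  have t: "t > 0" using q assms(13) by simp
  define R S where "R = r div t" and "S = s * int q div t"
  have tR: "r = t * R" by (simp add: R_def assms(13))
  have tS: "s * int q = t * S" by (simp add: S_def assms(13))
  have R: "R > 0" using tR r t by (simp add: zero_less_mult_iff)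
  have S: "S > 0"
  proof -
    have "t * S > 0" using s q by (simp flip: tS)
    then show ?thesis using t by (simp add: zero_less_mult_iff)
  qed
  have cop_rs: "coprime r s"
  proof (rule coprimeI)
    fix c assume "c dvd r" "c dvd s"
    then have "c dvd r\<^sup>2 - int D1 * s\<^sup>2" by (simp add: power2_eq_square)
    moreover have "is_unit (r\<^sup>2 - int D1 * s\<^sup>2)" using norm by simp
    ultimately show "is_unit c" by (rule dvd_trans)
  qed
  \<comment> \<open>As \<open>r\<close> is coprime to \<open>s\<close>,
    \<open>gcd r (s q) = gcd r q = t\<close>.\<close>
  have cop: "coprime R S"
  proof -
    have "gcd r (s * int q) = t"
      using gcd_mult_right_left_cancel[OF cop_rs, of "int q"] by (simp add: assms(13))
    then have "t * gcd R S = t" using t by (simp add: tR tS gcd_mult_left)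
    then show ?thesis using t by (simp add: coprime_iff_gcd_eq_1)
  qed
  have cf: "simple_cf_of a w" using assms(10) by (simp add: w_def)
  have a: "\<And>i. i > 0 \<Longrightarrow> a i > 0" using cf by (simp add: simple_cf_of_def)
  have norm_RS: "(of_int t)\<^sup>2 * ((of_int R)\<^sup>2 - w\<^sup>2 * (of_int S)\<^sup>2) = of_int (r\<^sup>2 - int D1 * s\<^sup>2)"
  proof -
    have "(of_int t)\<^sup>2 * ((of_int R)\<^sup>2 - w\<^sup>2 * (of_int S)\<^sup>2) = (of_int (t * R))\<^sup>2 - w\<^sup>2 * (of_int (t * S))\<^sup>2"
      by (simp add: algebra_simps power_mult_distrib)
    also have "\<dots> = of_int (r\<^sup>2 - int D1 * s\<^sup>2)"
      by (simp add: D1 power_mult_distrib flip: tR tS)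
    finally show ?thesis .
  qed
  have close: "\<bar>(of_int R)\<^sup>2 - w\<^sup>2 * (of_int S)\<^sup>2\<bar> \<le> 1"
  proof -
    have "(of_int t)\<^sup>2 * \<bar>(of_int R)\<^sup>2 - w\<^sup>2 * (of_int S)\<^sup>2\<bar>
        = \<bar>(of_int t)\<^sup>2 * ((of_int R)\<^sup>2 - w\<^sup>2 * (of_int S)\<^sup>2)\<bar>"
      by (simp add: abs_mult)
    also have "\<dots> = 1"
      by (simp only: norm_RS norm of_int_1 flip: of_int_abs)
    finally have "(of_int t)\<^sup>2 * \<bar>(of_int R)\<^sup>2 - w\<^sup>2 * (of_int S)\<^sup>2\<bar> = 1" .
    moreover have "1 * \<bar>(of_int R)\<^sup>2 - w\<^sup>2 * (of_int S)\<^sup>2\<bar> \<le> (of_int t)\<^sup>2 * \<bar>(of_int R)\<^sup>2 - w\<^sup>2 * (of_int S)\<^sup>2\<bar>"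
      using t by (intro mult_right_mono) simp_all
    ultimately show ?thesis by simp
  qed
  have "\<exists>k. (R, S) = cf_convergent a k"
    by (rule legendre_criterion[OF cf S cop square_close_imp_legendre[OF R S w1 close]])
  moreover have "\<exists>r' s' :: int.
         of_int r' + of_int s' * sqrt (real D1) \<in> Units (Z_sqrt D1) \<and>
         of_int r' + of_int s' * sqrt (real D1) \<noteq> of_int r + of_int s * sqrt (real D1) \<and>
         cf_convergent a (k + m + 1) = (r' div t, s' * int q div t) \<and>
         gcd r' (int q) = t"
    if k: "(R, S) = cf_convergent a k" for k
  proof -
    define cs where "cs = map b [1..<Suc m] @ [2 * b 0]"
    have a_eq: "a = periodic_cf (b 0) cs" using assms(9) by (simp add: cs_def)
    have len: "length cs = Suc m" by (simp add: cs_def)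
    have shift: "\<And>i. i > 0 \<Longrightarrow> a (Suc m + i) = a i"
      using periodic_cf_add_length[of _ "b 0" cs] by (simp only: a_eq len)
    have "cs \<noteq> []" "last cs = 2 * b 0" by (simp_all add: cs_def)
    then have head: "a (Suc m) = 2 * a 0"
      using periodic_cf_length[of cs "b 0"] by (simp add: a_eq len periodic_cf_0)
    have w2Q: "w\<^sup>2 \<in> \<rat>" by (simp add: w2)
    note per = cf shift head irr w2Q
    define P U V where "P = cf_num a (Suc (Suc m))" and "U = cf_den a (Suc (Suc m))"
      and "V = cf_num a (Suc (Suc m)) * int (a 0) + cf_num a (Suc m)"
    have V: "of_int V = w\<^sup>2 * of_int U"
      unfolding V_def U_def by (rule periodic_fixed_point(2)[OF per])
    have "real_of_int (V * int Q) = real_of_int (int D * U)"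
      using assms(2) by (simp add: V w2)
    then have "V * int Q = int D * U" by (simp only: of_int_eq_iff)
    then have "int Q dvd int D * U" by (metis dvd_triv_right)
    then have QU: "int Q dvd U"
      using assms(3) by (simp add: coprime_dvd_mult_right_iff coprime_commute)
    \<comment> \<open>Since \<open>sqrt D1 = q w\<close>, this rewrites \<open>P + U w\<close> as
      the element \<open>P + U' sqrt D1\<close> of the ring.\<close>
    then obtain U' where U': "U = int q * U'" using q by (meson dvd_def dvd_trans of_nat_dvd_iff)
    have U_pos: "U > 0" using cf_den_pos[of a m] a by (simp add: U_def)
    have P_pos: "P \<ge> 1"
    proof -
      have "P = U * int (a 0) + cf_den a (Suc m)"
        unfolding P_def U_def by (rule periodic_fixed_point(1)[OF per])
      moreover have "a 0 > 0" using assms(8) by (simp add: a_eq periodic_cf_0)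
      moreover have "cf_den a (Suc m) \<ge> 0"
        using cf_den_pos[of a "m - 1"] a by (cases m) simp_all
      ultimately show ?thesis using U_pos by (smt (verit) mult_pos_pos of_nat_0_less_iff)
    qed
    have normP: "P\<^sup>2 - int D1 * U'\<^sup>2 = (- 1) ^ Suc m"
    proof -
      have "real_of_int (P\<^sup>2 - int D1 * U'\<^sup>2) = (of_int P)\<^sup>2 - w\<^sup>2 * (of_int U)\<^sup>2"
        by (simp add: D1 U' power_mult_distrib)
      also have "\<dots> = (- 1) ^ Suc m"
        unfolding P_def U_def by (rule periodic_norm[OF per])
      finally have "real_of_int (P\<^sup>2 - int D1 * U'\<^sup>2) = real_of_int ((- 1) ^ Suc m)" by simp
      then show ?thesis by (simp only: of_int_eq_iff)
    qed
    \<comment> \<open>The coefficients of the product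
      \<open>(r + s sqrt D1) (P + U' sqrt D1)\<close>.\<close>
    define r' s' where "r' = r * P + int D1 * s * U'" and "s' = s * P + r * U'"
    have "r'\<^sup>2 - int D1 * s'\<^sup>2 = (r\<^sup>2 - int D1 * s\<^sup>2) * (P\<^sup>2 - int D1 * U'\<^sup>2)"
      by (simp add: r'_def s'_def algebra_simps power2_eq_square)
    moreover have "\<bar>(r\<^sup>2 - int D1 * s\<^sup>2) * (P\<^sup>2 - int D1 * U'\<^sup>2)\<bar> = 1"
      unfolding abs_mult norm normP by simp
    ultimately have unit: "of_int r' + of_int s' * sqrt (real D1) \<in> Units (Z_sqrt D1)"
      by (rule Z_sqrt_UnitsI)
    \<comment> \<open>Both coefficients grow, the second strictly, so the new unit is larger and
      hence different.\<close>
    have "U' > 0" using U_pos q by (simp add: U' zero_less_mult_iff)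
    then have "s' > s"
      using mult_left_mono[OF P_pos, of s] mult_pos_pos[of r U'] r s unfolding s'_def by linarith
    moreover have "r' \<ge> r"
    proof -
      have "r * 1 \<le> r * P" using P_pos r by (intro mult_left_mono) simp_all
      moreover have "int D1 * s * U' \<ge> 0" using \<open>U' > 0\<close> s by simp
      ultimately show ?thesis by (simp add: r'_def)
    qed
    moreover have "sqrt (real D1) > 0" using sqrtD1 w1 q by simp
    ultimately have "of_int r' + of_int s' * sqrt (real D1) > of_int r + of_int s * sqrt (real D1)"
      by (intro add_le_less_mono mult_strict_right_mono) simp_all
    moreover
    have RS: "R = cf_num a (Suc (Suc k))" "S = cf_den a (Suc (Suc k))"
      using k cf_convergent_continuants[of a k] a by simp_all
    have conv: "cf_convergent a (k + m + 1) = (P * R + V * S, U * R + P * S)"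
    proof -
      \<comment> \<open>The shift of two in the index of continuants goes with \<open>k\<close>,
        which leaves exactly one period of length \<open>m + 1\<close>.\<close>
      have "k + m + 1 + 2 = Suc m + Suc (Suc k)" by simp
      moreover have "cf_num a (Suc m + Suc (Suc k)) = P * R + V * S"
        unfolding RS P_def V_def by (rule periodic_num[OF per])
      moreover have "cf_den a (Suc m + Suc (Suc k)) = U * R + P * S"
        unfolding RS P_def U_def by (rule periodic_shift_den[OF per])
      ultimately show ?thesis
        by (simp only: cf_convergent_continuants[OF a])
    qed
    \<comment> \<open>Both sides equal \<open>w^2 q^2 U'\<close>.\<close>
    have VqD1: "int D1 * U' = int q * V"
    proof -
      have "real_of_int (int D1 * U') = real_of_int (int q * V)"
        by (simp add: D1 V U' power2_eq_square)
      then show ?thesis by (simp only: of_int_eq_iff)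
    qed
    have r'_eq: "r' = r * P + V * (s * int q)"
    proof -
      have "r' = r * P + (int D1 * U') * s" by (simp add: r'_def)
      then show ?thesis by (simp only: VqD1) simp
    qed
    have r't: "r' = t * (P * R + V * S)"
      unfolding r'_eq tS by (simp add: tR algebra_simps)
    have s't: "s' * int q = t * (U * R + P * S)"
    proof -
      have "s' * int q = P * (s * int q) + U * r" by (simp add: s'_def U' algebra_simps)
      then show ?thesis by (simp add: tS tR algebra_simps)
    qed
    have "cf_convergent a (k + m + 1) = (r' div t, s' * int q div t)"
      unfolding conv r't s't using t by simp
    moreover have "gcd r' (int q) = t"
    proof -
      \<comment> \<open>Modulo \<open>q\<close>, \<open>r'\<close> is \<open>r P\<close>, and
        \<open>P\<close> is coprime to \<open>U\<close>, hence to its divisor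
        \<open>q\<close>.\<close>
      have "r' = r * P + (V * s) * int q" by (simp add: r'_eq)
      then have "gcd r' (int q) = gcd (r * P) (int q)"
        by (metis add.commute gcd.commute gcd_add_mult)
      moreover have "coprime P (int q)"
      proof -
        have "coprime P U" unfolding P_def U_def by (rule cf_coprime)
        then show ?thesis by (simp add: U')
      qed
      ultimately show ?thesis
        by (simp add: assms(13) gcd_mult_left_right_cancel coprime_commute)
    qed
    ultimately show ?thesis using unit by (intro exI[of _ r'] exI[of _ s']) auto
  qed
  ultimately show ?thesis by (simp only: R_def S_def) blast
qed

end
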